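(* Let $b$ be a positive integer and let $a$ be an integer relatively prime to $b$ with $2\le a\le b-2$. Then $$\frac{b^2-1}{8}\le \operatorname{inv}(a,b)\le \frac{3b^2-12b+9}{8},$$ and equivalently $$-\frac{(b-1)(b-5)}{24b}\le s(a,b)\le \frac{(b-1)(b-5)}{24b}.$$ Moreover, if $b$ is odd, then $$\operatorname{inv}(2,b)=\frac{b^2-1}{8},\qquad \operatorname{inv}(-2,b)=\frac{3b^2-12b+9}{8},$$ $$s(2,b)=\frac{(b-1)(b-5)}{24b},\qquad s(-2,b)=-\frac{(b-1)(b-5)}{24b}.$$
   Context: For a permutation $\sigma$ of $\{1,2,\dots,b\}$, its inversion number is $\operatorname{inv}(\sigma)=\#\{(i,j) : 1\le i<j\le b,\ \sigma(i)>\sigma(j)\}$. If $a$ is an integer relatively prime to $b$, let $\sigma_a:\{1,\dots,b\}\to\{1,\dots,b\}$ be the permutation sending $x$ to the unique element of $\{1,\dots,b\}$ congruent to $ax$ modulo $b$, and put $\operatorname{inv}(a,b)=\operatorname{inv}(\sigma_a)$. For relatively prime integers $a$ and $b$ with $b\ge 1$, the Dedekind sum is $s(a,b)=\sum_{i=1}^{b-1}\frac{i}{b}\left(\!\left(\frac{ai}{b}\right)\!\right)$, where $((x))=0$ if $x\in\mathbb{Z}$ and $((x))=x-\lfloor x\rfloor-\frac12$ if $x\notin\mathbb{Z}$. *)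

theory Defs
  imports Complex_Main "HOL-Number_Theory.Cong" "HOL-Combinatorics.Permutations"
begin

definition inversion_number :: "int \<Rightarrow> (int \<Rightarrow> int) \<Rightarrow> nat" where
  "inversion_number b \<sigma> = card {(i, j). 1 \<le> i \<and> i < j \<and> j \<le> b \<and> \<sigma> i > \<sigma> j}"

text \<open>
  Following the library's convention for permutations of a set, the map is extended by the
  identity outside \<open>{1..b}\<close>.
\<close>

definition mult_perm :: "int \<Rightarrow> int \<Rightarrow> int \<Rightarrow> int" where
  "mult_perm a b x =
     (if x \<in> {1..b} then THE y. y \<in> {1..b} \<and> [y = a * x] (mod b) else x)"

lemma ex1_cong_atLeastAtMost:
  fixes b z :: int
  assumes "b > 0"
  shows "\<exists>!y. y \<in> {1..b} \<and> [y = z] (mod b)"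
proof (rule ex1I)
  show "(z - 1) mod b + 1 \<in> {1..b} \<and> [(z - 1) mod b + 1 = z] (mod b)"
    using assms by (auto simp: cong_def mod_simps add1_zle_eq)
next
  fix y assume y: "y \<in> {1..b} \<and> [y = z] (mod b)"
  then have "[y - 1 = z - 1] (mod b)"
    by (intro cong_diff) auto
  then show "y = (z - 1) mod b + 1"
    using y by (simp add: cong_def)
qed

lemma mult_perm_props:
  assumes "b > 0" "x \<in> {1..b}"
  shows "mult_perm a b x \<in> {1..b}" "[mult_perm a b x = a * x] (mod b)"
  using theI'[OF ex1_cong_atLeastAtMost[OF assms(1), of "a * x"]] assms(2)
  unfolding mult_perm_def by auto

lemma mult_perm_permutes:
  assumes "b > 0" "coprime a b"
  shows "mult_perm a b permutes {1..b}"
proof (rule bij_imp_permutes)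
  have "inj_on (mult_perm a b) {1..b}"
  proof (rule inj_onI)
    fix x y assume xy: "x \<in> {1..b}" "y \<in> {1..b}" "mult_perm a b x = mult_perm a b y"
    then have "[a * x = a * y] (mod b)"
      using mult_perm_props(2)[OF assms(1)] by (metis cong_sym cong_trans)
    then have "[x = y] (mod b)"
      using assms(2) by (simp add: cong_mult_lcancel)
    then show "x = y"
      using ex1_cong_atLeastAtMost[OF assms(1), of y] xy cong_refl by blast
  qed
  moreover have "mult_perm a b ` {1..b} \<subseteq> {1..b}"
    using mult_perm_props(1)[OF assms(1)] by blast
  ultimately show "bij_betw (mult_perm a b) {1..b} {1..b}"
    by (simp add: bij_betw_def endo_inj_surj)
qed (auto simp: mult_perm_def)

definition inv_mult :: "int \<Rightarrow> int \<Rightarrow> nat" where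
  "inv_mult a b = inversion_number b (mult_perm a b)"

definition sawtooth :: "real \<Rightarrow> real" where
  "sawtooth x = (if x \<in> \<int> then 0 else x - of_int \<lfloor>x\<rfloor> - 1 / 2)"

definition dedekind_sum :: "int \<Rightarrow> int \<Rightarrow> real" where
  "dedekind_sum a b =
     (\<Sum>i = 1..b - 1. of_int i / of_int b * sawtooth (of_int (a * i) / of_int b))"

end

theory Submission
  imports Defs
begin

text \<open>
  Write \<open>r i = (a * i) mod b\<close>. Whether \<open>i < j\<close> is an inversion depends on whether subtracting
  \<open>r i\<close> from \<open>r j\<close> needs a borrow, and the borrow is visible in \<open>r (j - i)\<close>; hence the number of
  inversions is a linear combination of the residues \<open>r i\<close>. So is the Dedekind sum, and since the
  \<open>r i\<close> are a permutation of \<open>1, \<dots>, b - 1\<close>, both are affine functions of the single quantity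
  \<open>\<Sum>i. i * r i\<close>. Eliminating it gives \<open>inv(a, b) = (b - 1) (b - 2) / 4 - 3 b s(a, b)\<close>
  (\<open>inv_mult_eq_dedekind_sum\<close>), which makes the two pairs of inequalities equivalent, so that
  only the Dedekind sum has to be bounded.

  The rearrangement inequality gives \<open>\<bar>s(a, b)\<bar> \<le> s(1, b) = (b - 1) (b - 2) / (12 b)\<close>
  (\<open>abs_dedekind_sum_le\<close>), which is about twice too large. The reciprocity law
  (\<open>dedekind_sum_reciprocity\<close>) expresses \<open>s(a, b)\<close> by \<open>s(b, a)\<close>, and the same trivial bound
  applied to \<open>s(b, a)\<close>, whose modulus \<open>a\<close> is smaller, becomes sharp enough. For
  \<open>2 \<le> a \<le> (b - 1) / 2\<close> the resulting upper estimate is a convex function of \<open>a\<close> whose values at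
  \<open>a = 2\<close> and at \<open>a = (b + 1) / 2\<close> both equal the required bound, and the lower estimate
  decreases to the required bound at \<open>a = (b - 1) / 2\<close>. The remaining \<open>a\<close> follow from
  \<open>s(b - a, b) = - s(a, b)\<close>; the value \<open>a = b / 2\<close> is excluded by coprimality. For \<open>a = 2\<close> the
  reciprocal sum \<open>s(b, 2)\<close> vanishes, which gives the stated equalities.
\<close>

section \<open>Residues of multiples\<close>

lemma sum_int_id:
  fixes n :: int
  assumes "n \<ge> 0"
  shows "2 * (\<Sum>i = 1..n. i) = n * (n + 1)"
  using assms
proof (induction n rule: int_ge_induct)
  case (step n)
  then have "{1..n + 1} = insert (n + 1) {1..n}" by auto
  with step show ?case by (simp add: algebra_simps)
qed simp

lemma sum_int_squares:
  fixes n :: int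
  assumes "n \<ge> 0"
  shows "6 * (\<Sum>i = 1..n. i\<^sup>2) = n * (n + 1) * (2 * n + 1)"
  using assms
proof (induction n rule: int_ge_induct)
  case (step n)
  then have "{1..n + 1} = insert (n + 1) {1..n}" by auto
  with step show ?case by (simp add: algebra_simps power2_eq_square)
qed simp

lemma mult_mod_bounds:
  fixes a b i :: int
  assumes "coprime a b" "i \<in> {1..b - 1}"
  shows "(a * i) mod b \<in> {1..b - 1}"
proof -
  have b: "b > 0" using assms(2) by auto
  have "\<not> b dvd i" using assms(2) zdvd_not_zless by auto
  then have "\<not> b dvd a * i"
    using assms(1) by (simp add: coprime_commute coprime_dvd_mult_right_iff)
  then have "(a * i) mod b \<noteq> 0" by auto
  moreover have "0 \<le> (a * i) mod b" "(a * i) mod b < b" using b by auto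
  ultimately show ?thesis by auto
qed

lemma bij_betw_mult_mod:
  fixes a b :: int
  assumes "coprime a b"
  shows "bij_betw (\<lambda>i. (a * i) mod b) {1..b - 1} {1..b - 1}"
proof -
  have "inj_on (\<lambda>i. (a * i) mod b) {1..b - 1}"
  proof (rule inj_onI)
    fix i j assume ij: "i \<in> {1..b - 1}" "j \<in> {1..b - 1}" "(a * i) mod b = (a * j) mod b"
    then have "[i = j] (mod b)"
      using assms by (simp add: cong_def cong_mult_lcancel flip: cong_def)
    then show "i = j" using ij by (simp add: cong_def)
  qed
  moreover have "(\<lambda>i. (a * i) mod b) ` {1..b - 1} \<subseteq> {1..b - 1}"
    using mult_mod_bounds[OF assms] by blast
  ultimately show ?thesis by (simp add: bij_betw_def endo_inj_surj)
qed

lemma sum_over_residues: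
  fixes a b :: int
  assumes "coprime a b"
  shows "(\<Sum>i = 1..b - 1. g ((a * i) mod b)) = (\<Sum>i = 1..b - 1. g i)"
  using sum.reindex_bij_betw[OF bij_betw_mult_mod[OF assms]] .

section \<open>Inversions and Dedekind sums as sums over residues\<close>

lemma mult_perm_eq_mod:
  assumes "coprime a b" "i \<in> {1..b - 1}"
  shows "mult_perm a b i = (a * i) mod b"
proof -
  have b: "b > 0" and i: "i \<in> {1..b}" using assms(2) by auto
  have "(a * i) mod b \<in> {1..b}" "[(a * i) mod b = a * i] (mod b)"
    using mult_mod_bounds[OF assms] by auto
  then show ?thesis
    using ex1_cong_atLeastAtMost[OF b, of "a * i"] mult_perm_props[OF b i, of a] by blast
qed

lemma mult_perm_self:
  assumes "b > 0"
  shows "mult_perm a b b = b"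
proof -
  have "mult_perm a b b \<in> {1..b}" "[mult_perm a b b = a * b] (mod b)"
    using mult_perm_props[OF assms, of b a] assms by auto
  moreover have "[b = a * b] (mod b)" by (simp add: cong_def)
  ultimately show ?thesis
    using ex1_cong_atLeastAtMost[OF assms, of "a * b"] assms by auto
qed

text \<open>
  The residue of \<open>a * (j - i)\<close> is the difference of the residues, corrected by one \<open>b\<close> exactly
  when that difference is negative. This turns the condition for an inversion into a linear
  expression.
\<close>

lemma descent_indicator:
  fixes a b i j :: int
  assumes "b > 0"
  shows "b * of_bool ((a * i) mod b > (a * j) mod b) =
         (a * i) mod b - (a * j) mod b + (a * (j - i)) mod b"
proof -
  let ?r = "\<lambda>i. (a * i) mod b"
  have "?r (j - i) = (?r j - ?r i) mod b"
    by (simp add: mod_simps algebra_simps)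
  also have "\<dots> = ?r j - ?r i + b * of_bool (?r i > ?r j)"
  proof (cases "?r i > ?r j")
    case True
    have "(?r j - ?r i) mod b = (?r j - ?r i + b) mod b" by simp
    also have "\<dots> = ?r j - ?r i + b"
      using True assms pos_mod_bound[of b "a * i"] pos_mod_sign[of b "a * j"]
      by (intro mod_pos_pos_trivial) linarith+
    finally show ?thesis using True by simp
  next
    case False
    have "(?r j - ?r i) mod b = ?r j - ?r i"
      using False assms pos_mod_bound[of b "a * j"] pos_mod_sign[of b "a * i"]
      by (intro mod_pos_pos_trivial) linarith+
    then show ?thesis using False by simp
  qed
  finally show ?thesis by simp
qed

lemma sum_below_triangle:
  fixes n :: int and r :: "int \<Rightarrow> int"
  shows "(\<Sum>j = 1..n. \<Sum>i = 1..j - 1. r i) = (\<Sum>i = 1..n. (n - i) * r i)"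
proof -
  have "(\<Sum>j = 1..n. \<Sum>i = 1..j - 1. r i) = (\<Sum>j = 1..n. \<Sum>i | i \<in> {1..n} \<and> i < j. r i)"
    by (intro sum.cong) auto
  also have "\<dots> = (\<Sum>i = 1..n. \<Sum>j | j \<in> {1..n} \<and> i < j. r i)"
    by (rule sum.swap_restrict) auto
  also have "\<dots> = (\<Sum>i = 1..n. \<Sum>j = i + 1..n. r i)"
    by (intro sum.cong) auto
  finally show ?thesis by simp
qed

text \<open>
  Summing \<open>descent_indicator\<close> over all pairs \<open>i < j\<close>: each \<open>r i\<close> occurs \<open>b - 1 - i\<close> times as the
  earlier entry and \<open>i - 1\<close> times, negatively, as the later one, and the differences \<open>j - i\<close>
  run through every \<open>i\<close> another \<open>b - 1 - i\<close> times.
\<close>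

lemma inv_mult_residues:
  assumes "b > 0" "coprime a b"
  shows "b * int (inv_mult a b) = (\<Sum>i = 1..b - 1. (2 * b - 1 - 3 * i) * ((a * i) mod b))"
proof -
  define r where "r i = (a * i) mod b" for i
  have "{(i, j). 1 \<le> i \<and> i < j \<and> j \<le> b \<and> mult_perm a b i > mult_perm a b j} =
        (\<lambda>(j, i). (i, j)) ` (SIGMA j:{1..b - 1}. {i \<in> {1..j - 1}. r i > r j})" (is "?L = ?R")
  proof (intro equalityI subsetI)
    fix p assume "p \<in> ?L"
    then obtain i j where ij: "p = (i, j)" "1 \<le> i" "i < j" "j \<le> b" "mult_perm a b i > mult_perm a b j"
      by auto
    have "mult_perm a b i \<le> b" using mult_perm_props(1)[OF assms(1), of i a] ij by auto
    \<comment> \<open>The last entry is the fixed maximum \<open>b\<close>, so it takes part in no inversion.\<close>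
    then have "j \<noteq> b" using ij mult_perm_self[OF assms(1), of a] by auto
    then show "p \<in> ?R"
      using ij mult_perm_eq_mod[OF assms(2)] by (auto simp: r_def image_iff)
  qed (use mult_perm_eq_mod[OF assms(2)] in \<open>auto simp: r_def\<close>)
  moreover have "inj_on (\<lambda>(j, i). (i, j)) (SIGMA j:{1..b - 1}. {i \<in> {1..j - 1}. r i > r j})"
    by (auto simp: inj_on_def)
  ultimately have "int (inv_mult a b) = (\<Sum>j = 1..b - 1. int (card {i \<in> {1..j - 1}. r i > r j}))"
    by (simp add: inv_mult_def inversion_number_def card_image card_SigmaI
        del: atLeastAtMost_iff)
  also have "\<dots> = (\<Sum>j = 1..b - 1. \<Sum>i = 1..j - 1. of_bool (r i > r j))"
    by (simp add: Int_def)
  finally have "b * int (inv_mult a b) =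
      (\<Sum>j = 1..b - 1. \<Sum>i = 1..j - 1. b * of_bool (r i > r j))"
    by (simp only: sum_distrib_left)
  also have "\<dots> = (\<Sum>j = 1..b - 1. \<Sum>i = 1..j - 1. r i - r j + r (j - i))"
    by (simp only: r_def descent_indicator[OF assms(1)])
  also have "\<dots> = (\<Sum>j = 1..b - 1. 2 * (\<Sum>i = 1..j - 1. r i) - (j - 1) * r j)"
  proof (intro sum.cong refl)
    fix j assume "j \<in> {1..b - 1}"
    moreover have "(\<Sum>i = 1..j - 1. r (j - i)) = (\<Sum>i = 1..j - 1. r i)"
      by (rule sum.reindex_bij_witness[of _ "\<lambda>i. j - i" "\<lambda>i. j - i"]) auto
    ultimately show "(\<Sum>i = 1..j - 1. r i - r j + r (j - i)) = 2 * (\<Sum>i = 1..j - 1. r i) - (j - 1) * r j"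
      by (simp add: sum.distrib sum_subtractf)
  qed
  also have "\<dots> = (\<Sum>i = 1..b - 1. (2 * b - 1 - 3 * i) * r i)"
  proof -
    have "(\<Sum>j = 1..b - 1. 2 * (\<Sum>i = 1..j - 1. r i) - (j - 1) * r j) =
        2 * (\<Sum>i = 1..b - 1. (b - 1 - i) * r i) - (\<Sum>j = 1..b - 1. (j - 1) * r j)"
      by (simp only: sum_subtractf sum_below_triangle flip: sum_distrib_left)
    also have "\<dots> = (\<Sum>i = 1..b - 1. 2 * ((b - 1 - i) * r i) - (i - 1) * r i)"
      by (simp only: sum_subtractf sum_distrib_left)
    finally show ?thesis by (simp add: algebra_simps)
  qed
  finally show ?thesis by (simp add: r_def)
qed

lemma dedekind_sum_residues:
  assumes "b > 0" "coprime a b"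
  shows "dedekind_sum a b =
         of_int (\<Sum>i = 1..b - 1. i * ((a * i) mod b)) / of_int b ^ 2 - (of_int b - 1) / 4"
proof -
  have saw: "sawtooth (of_int (a * i) / of_int b) = of_int ((a * i) mod b) / of_int b - 1 / 2"
    if i: "i \<in> {1..b - 1}" for i
  proof -
    have "\<not> b dvd a * i" using mult_mod_bounds[OF assms(2) i] by auto
    then have "of_int (a * i) / real_of_int b \<notin> \<int>"
      using assms(1) by (subst of_int_div_of_int_in_Ints_iff) auto
    moreover have "of_int (a * i) / real_of_int b - of_int \<lfloor>of_int (a * i) / real_of_int b\<rfloor> =
        of_int ((a * i) mod b) / of_int b"
      using assms(1) by (simp add: floor_divide_of_int_eq minus_div_mult_eq_mod[symmetric] field_simps
          del: of_int_mult) (simp add: field_simps)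
    ultimately show ?thesis by (simp add: sawtooth_def)
  qed
  have "dedekind_sum a b = (\<Sum>i = 1..b - 1. of_int (i * ((a * i) mod b)) / of_int b ^ 2 - of_int i / (2 * of_int b))"
    unfolding dedekind_sum_def
    by (intro sum.cong refl, subst saw) (simp_all add: algebra_simps power2_eq_square)
  also have "\<dots> = of_int (\<Sum>i = 1..b - 1. i * ((a * i) mod b)) / of_int b ^ 2 -
      of_int (\<Sum>i = 1..b - 1. i) / (2 * of_int b)"
    by (simp add: sum_subtractf sum_divide_distrib)
  also have "real_of_int (\<Sum>i = 1..b - 1. i) = of_int b * (of_int b - 1) / 2"
    using arg_cong[OF sum_int_id[of "b - 1"], of real_of_int] assms(1) by (simp add: field_simps)
  also have "of_int b * (of_int b - 1) / 2 / (2 * of_int b) = (of_int b - 1) / (4 :: real)"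
    using assms(1) by simp
  finally show ?thesis .
qed

text \<open>
  Both sides are affine in \<open>\<Sum>i. i * r i\<close>, because \<open>\<Sum>i. r i = \<Sum>i. i\<close>.
\<close>

theorem inv_mult_eq_dedekind_sum:
  assumes "b > 0" "coprime a b"
  shows "real (inv_mult a b) =
         (of_int b - 1) * (of_int b - 2) / 4 - 3 * of_int b * dedekind_sum a b"
proof -
  define T where "T = (\<Sum>i = 1..b - 1. i * ((a * i) mod b))"
  have "b * int (inv_mult a b) = (2 * b - 1) * (\<Sum>i = 1..b - 1. (a * i) mod b) - 3 * T"
    unfolding inv_mult_residues[OF assms] T_def
    by (simp add: algebra_simps sum_subtractf sum.distrib sum_distrib_left)
  also have "(\<Sum>i = 1..b - 1. (a * i) mod b) = (\<Sum>i = 1..b - 1. i)"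
    by (rule sum_over_residues[OF assms(2)])
  finally have "2 * b * int (inv_mult a b) = (2 * b - 1) * ((b - 1) * b) - 6 * T"
    using sum_int_id[of "b - 1"] assms(1) by (simp add: algebra_simps)
  then have "2 * real_of_int b * real (inv_mult a b) =
      (2 * of_int b - 1) * ((of_int b - 1) * of_int b) - 6 * of_int T"
    by (simp flip: of_int_eq_iff[where 'a = real])
  moreover have "4 * of_int T = of_int b ^ 2 * (4 * dedekind_sum a b + (of_int b - 1))"
    using assms(1) by (simp add: dedekind_sum_residues[OF assms] T_def field_simps)
  ultimately have "of_int b * (4 * real (inv_mult a b)) =
      of_int b * ((of_int b - 1) * (of_int b - 2) - 12 * of_int b * dedekind_sum a b)"
    by (simp add: algebra_simps power2_eq_square)
  then show ?thesis using assms(1) by (simp only: mult_cancel_left) simp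
qed

section \<open>Symmetry and the trivial bound\<close>

lemma dedekind_sum_cong:
  assumes "[a = a'] (mod b)" "b > 0" "coprime a b"
  shows "dedekind_sum a b = dedekind_sum a' b"
proof -
  have "coprime a' b" using assms(1,3) cong_imp_coprime by blast
  moreover have "(a * i) mod b = (a' * i) mod b" for i
    using assms(1) by (metis cong_def cong_scalar_right)
  ultimately show ?thesis using assms by (simp add: dedekind_sum_residues)
qed

lemma sawtooth_uminus: "sawtooth (- x) = - sawtooth x"
proof (cases "x \<in> \<int>")
  case False
  then have "x \<noteq> of_int \<lfloor>x\<rfloor>" by (metis Ints_of_int)
  then have "\<lceil>x\<rceil> = \<lfloor>x\<rfloor> + 1" by (simp add: ceiling_altdef)
  with False show ?thesis by (simp add: sawtooth_def ceiling_def)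
qed (simp add: sawtooth_def)

lemma dedekind_sum_uminus: "dedekind_sum (- a) b = - dedekind_sum a b"
  by (simp add: dedekind_sum_def sawtooth_uminus sum_negf)

text \<open>
  The sum \<open>\<Sum>i. i * r i\<close> is largest when \<open>r i = i\<close>: expand \<open>0 \<le> \<Sum>i. (i - r i)\<^sup>2\<close>, where
  \<open>\<Sum>i. (r i)\<^sup>2 = \<Sum>i. i\<^sup>2\<close>.
\<close>

lemma dedekind_sum_le:
  assumes "b > 0" "coprime a b"
  shows "dedekind_sum a b \<le> (of_int b - 1) * (of_int b - 2) / (12 * of_int b)"
proof -
  define T where "T = (\<Sum>i = 1..b - 1. i * ((a * i) mod b))"
  have "0 \<le> (\<Sum>i = 1..b - 1. (i - (a * i) mod b)\<^sup>2)" by (intro sum_nonneg) auto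
  also have "\<dots> = (\<Sum>i = 1..b - 1. i\<^sup>2) + (\<Sum>i = 1..b - 1. ((a * i) mod b)\<^sup>2) - 2 * T"
    by (simp add: T_def power2_diff sum.distrib sum_subtractf sum_distrib_left algebra_simps)
  also have "(\<Sum>i = 1..b - 1. ((a * i) mod b)\<^sup>2) = (\<Sum>i = 1..b - 1. i\<^sup>2)"
    by (rule sum_over_residues[OF assms(2)])
  finally have "6 * T \<le> (b - 1) * b * (2 * b - 1)"
    using sum_int_squares[of "b - 1"] assms(1) by simp
  then have "6 * real_of_int T \<le> (of_int b - 1) * of_int b * (2 * of_int b - 1)"
    by (simp flip: of_int_le_iff[where 'a = real])
  then have "6 * real_of_int T / (6 * of_int b ^ 2) \<le>
      (of_int b - 1) * of_int b * (2 * of_int b - 1) / (6 * of_int b ^ 2)"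
    by (intro divide_right_mono) auto
  also have "\<dots> = (of_int b - 1) * (of_int b - 2) / (12 * of_int b) + (of_int b - 1) / 4"
    using assms(1) by (simp add: field_simps power2_eq_square)
  finally show ?thesis
    by (simp add: dedekind_sum_residues[OF assms] T_def)
qed

lemma abs_dedekind_sum_le:
  assumes "b > 0" "coprime a b"
  shows "\<bar>dedekind_sum a b\<bar> \<le> (of_int b - 1) * (of_int b - 2) / (12 * of_int b)"
  using dedekind_sum_le[OF assms] dedekind_sum_le[of b "- a"] assms
  by (simp add: dedekind_sum_uminus abs_le_iff)

section \<open>Reciprocity\<close>

lemma le_div_iff_mult_le:
  fixes b j n :: int
  assumes "b > 0"
  shows "j \<le> n div b \<longleftrightarrow> b * j \<le> n"
proof
  assume "j \<le> n div b"
  then have "b * j \<le> b * (n div b)" using assms by simp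
  also have "\<dots> \<le> n" using assms pos_mod_sign[of b n] mult_div_mod_eq[of b n] by linarith
  finally show "b * j \<le> n" .
next
  assume "b * j \<le> n"
  then show "j \<le> n div b" using zdiv_mono1[of "b * j" n b] assms by simp
qed

text \<open>
  Each side is twice the sum of the heights \<open>j\<close> of the lattice points \<open>(i, j)\<close> with
  \<open>1 \<le> i < b\<close> and \<open>1 \<le> j\<close> below the line from \<open>(0, 0)\<close> to \<open>(b, a)\<close>, summed by columns on the
  left and by rows on the right. By coprimality no such point lies on the line.
\<close>

lemma sum_floor_triangular:
  fixes a b :: int
  assumes "a > 0" "b > 0" "coprime a b"
  shows "(\<Sum>i = 1..b - 1. ((a * i) div b) * ((a * i) div b + 1)) =
         2 * (\<Sum>j = 1..a - 1. j * (b - 1 - (b * j) div a))"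
proof -
  have "(\<Sum>i = 1..b - 1. ((a * i) div b) * ((a * i) div b + 1)) =
        (\<Sum>i = 1..b - 1. 2 * (\<Sum>j | j \<in> {1..a - 1} \<and> b * j \<le> a * i. j))"
  proof (intro sum.cong refl)
    fix i assume i: "i \<in> {1..b - 1}"
    have le_div: "j \<le> (a * i) div b \<longleftrightarrow> b * j \<le> a * i" for j
      by (rule le_div_iff_mult_le[OF assms(2)])
    have "a * i < b * a" using i assms(1) by simp
    then have "(a * i) div b < a"
      using le_div[of a] by linarith
    moreover note le_div
    ultimately have "{j \<in> {1..a - 1}. b * j \<le> a * i} = {1..(a * i) div b}" by force
    moreover have "(a * i) div b \<ge> 0" using i assms(1,2) by (simp add: pos_imp_zdiv_nonneg_iff)
    ultimately show "((a * i) div b) * ((a * i) div b + 1) =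
        2 * (\<Sum>j | j \<in> {1..a - 1} \<and> b * j \<le> a * i. j)"
      using sum_int_id[of "(a * i) div b"] by simp
  qed
  also have "\<dots> = 2 * (\<Sum>j = 1..a - 1. \<Sum>i | i \<in> {1..b - 1} \<and> b * j \<le> a * i. j)"
    by (simp only: sum_distrib_left[symmetric]) (subst sum.swap_restrict, auto)
  also have "(\<Sum>j = 1..a - 1. \<Sum>i | i \<in> {1..b - 1} \<and> b * j \<le> a * i. j) =
      (\<Sum>j = 1..a - 1. j * (b - 1 - (b * j) div a))"
  proof (intro sum.cong refl)
    fix j assume j: "j \<in> {1..a - 1}"
    have "(b * j) mod a \<noteq> 0"
      using mult_mod_bounds[of b a j] j assms(3) by (auto simp: coprime_commute)
    then have "b * j \<noteq> a * i" for i by auto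
    then have div_less: "b * j \<le> a * i \<longleftrightarrow> (b * j) div a < i" for i
      using le_div_iff_mult_le[OF assms(1), of i "b * j"] by (smt (verit))
    have nonneg: "(b * j) div a \<ge> 0" using j assms(1,2) by (simp add: pos_imp_zdiv_nonneg_iff)
    have "b * j \<le> a * b" using j assms(2) by simp
    then have less: "(b * j) div a < b" by (simp only: div_less)
    have "{i \<in> {1..b - 1}. b * j \<le> a * i} = {(b * j) div a + 1..b - 1}"
      unfolding div_less using nonneg by auto
    with less show "(\<Sum>i | i \<in> {1..b - 1} \<and> b * j \<le> a * i. j) = j * (b - 1 - (b * j) div a)"
      by simp
  qed
  finally show ?thesis .
qed

text \<open>
  With \<open>f i = (a * i) div b\<close> we have \<open>r i = a * i - b * f i\<close>. As the \<open>r i\<close> permute the \<open>i\<close>,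
  comparing \<open>\<Sum>i. r i\<close> and \<open>\<Sum>i. (r i)\<^sup>2\<close> with \<open>\<Sum>i. i\<close> and \<open>\<Sum>i. i\<^sup>2\<close> determines \<open>\<Sum>i. f i\<close> and
  relates \<open>\<Sum>i. i * f i\<close>, which carries \<open>s(a, b)\<close>, to \<open>\<Sum>i. (f i)\<^sup>2\<close>. The lattice point count
  relates the latter to \<open>\<Sum>j. j * ((b * j) div a)\<close>, which carries \<open>s(b, a)\<close>.
\<close>

theorem dedekind_sum_reciprocity:
  fixes a b :: int
  assumes "a > 0" "b > 0" "coprime a b"
  shows "12 * (dedekind_sum a b + dedekind_sum b a) =
         of_int a / of_int b + of_int b / of_int a + 1 / (of_int a * of_int b) - 3"
proof -
  define f where "f i = (a * i) div b" for i
  define g where "g j = (b * j) div a" for j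
  define F where "F = (\<Sum>i = 1..b - 1. i * f i)"
  define G where "G = (\<Sum>j = 1..a - 1. j * g j)"
  define Sa where "Sa = (\<Sum>j = 1..a - 1. j\<^sup>2)"
  define Sb where "Sb = (\<Sum>i = 1..b - 1. i\<^sup>2)"
  define Ia where "Ia = (\<Sum>j = 1..a - 1. j)"
  define Ib where "Ib = (\<Sum>i = 1..b - 1. i)"
  define Q where "Q = (\<Sum>i = 1..b - 1. (f i)\<^sup>2)"
  define L where "L = (\<Sum>i = 1..b - 1. f i)"
  have rf: "(a * i) mod b = a * i - b * f i" for i
    by (simp add: f_def minus_mult_div_eq_mod)
  have rg: "(b * j) mod a = b * j - a * g j" for j
    by (simp add: g_def minus_mult_div_eq_mod)
  have lin: "a * Ib - b * L = Ib"
    using sum_over_residues[OF assms(3), of "\<lambda>x. x"]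
    by (simp add: rf Ib_def L_def sum_subtractf sum_distrib_left)
  have quad: "a\<^sup>2 * Sb - 2 * a * b * F + b\<^sup>2 * Q = Sb"
    using sum_over_residues[OF assms(3), of "\<lambda>x. x\<^sup>2"] unfolding rf
    by (simp add: Sb_def Q_def F_def sum_subtractf sum.distrib sum_distrib_left power2_diff
        algebra_simps)
  have tri: "Q + L = 2 * ((b - 1) * Ia - G)"
    using sum_floor_triangular[OF assms]
    by (simp add: Q_def L_def Ia_def G_def f_def g_def sum_subtractf sum.distrib sum_distrib_left
        power2_eq_square algebra_simps)
  have s1: "2 * Ia = (a - 1) * a" "2 * Ib = (b - 1) * b"
    and s2: "6 * Sa = (a - 1) * a * (2 * a - 1)" "6 * Sb = (b - 1) * b * (2 * b - 1)"
    using sum_int_id[of "a - 1"] sum_int_id[of "b - 1"] sum_int_squares[of "a - 1"]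
      sum_int_squares[of "b - 1"] assms by (auto simp: Ia_def Ib_def Sa_def Sb_def)
  have Tf: "(\<Sum>i = 1..b - 1. i * ((a * i) mod b)) = a * Sb - b * F"
    unfolding rf by (simp add: Sb_def F_def sum_subtractf sum_distrib_left power2_eq_square algebra_simps)
  have Tg: "(\<Sum>j = 1..a - 1. j * ((b * j) mod a)) = b * Sa - a * G"
    unfolding rg by (simp add: Sa_def G_def sum_subtractf sum_distrib_left power2_eq_square algebra_simps)
  have "coprime b a" using assms(3) by (simp add: coprime_commute)
  have "b * L = (a - 1) * Ib" using lin by (simp add: algebra_simps)
  then have L: "2 * (b * L) = (a - 1) * ((b - 1) * b)" using s1(2) by simp
  have Q: "Q = 2 * ((b - 1) * Ia - G) - L" using tri by simp
  have "b * (12 * (a * F + b * G)) = (a\<^sup>2 - 1) * (6 * Sb) + 6 * b\<^sup>2 * Q + 12 * b\<^sup>2 * G"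
    using quad by (simp add: algebra_simps power2_eq_square)
  also have "\<dots> = (a\<^sup>2 - 1) * (6 * Sb) + 6 * b\<^sup>2 * (b - 1) * (2 * Ia) - 3 * b * (2 * (b * L))"
    unfolding Q by (simp add: algebra_simps power2_eq_square)
  also have "\<dots> = b * ((a\<^sup>2 - 1) * (b - 1) * (2 * b - 1) + 3 * b * (b - 1) * (a - 1) * (2 * a - 1))"
    unfolding L s1 s2 by (simp add: algebra_simps power2_eq_square)
  finally have "12 * (a * F + b * G) =
      (a\<^sup>2 - 1) * (b - 1) * (2 * b - 1) + 3 * b * (b - 1) * (a - 1) * (2 * a - 1)"
    using assms(2) by simp
  then have FG: "12 * (of_int a * of_int F + of_int b * of_int G) =
      (of_int a ^ 2 - 1) * (of_int b - 1) * (2 * of_int b - 1) +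
      3 * of_int b * (of_int b - 1) * (of_int a - 1) * (2 * of_int a - (1::real))"
    by (simp flip: of_int_eq_iff[where 'a = real])
  have S: "6 * real_of_int Sa = (of_int a - 1) * of_int a * (2 * of_int a - 1)"
    "6 * real_of_int Sb = (of_int b - 1) * of_int b * (2 * of_int b - 1)"
    using s2 by (simp_all flip: of_int_eq_iff[where 'a = real])
  define s where "s = dedekind_sum a b"
  define t where "t = dedekind_sum b a"
  have s: "4 * (of_int a * of_int Sb - of_int b * of_int F) = of_int b ^ 2 * (4 * s + of_int b - 1)"
    using assms(2) unfolding s_def dedekind_sum_residues[OF assms(2,3)] Tf
    by (simp add: field_simps)
  have t: "4 * (of_int b * of_int Sa - of_int a * of_int G) = of_int a ^ 2 * (4 * t + of_int a - 1)"
    using assms(1) unfolding t_def dedekind_sum_residues[OF assms(1) \<open>coprime b a\<close>] Tg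
    by (simp add: field_simps)
  define A B where "A = real_of_int a" and "B = real_of_int b"
  have "(A * B) * (12 * A * B * (s + t)) =
      3 * A\<^sup>2 * (B\<^sup>2 * (4 * s + B - 1)) + 3 * B\<^sup>2 * (A\<^sup>2 * (4 * t + A - 1)) - 3 * A\<^sup>2 * B\<^sup>2 * (A + B - 2)"
    by (simp add: algebra_simps power2_eq_square)
  also have "\<dots> = 2 * A^3 * (6 * of_int Sb) + 2 * B^3 * (6 * of_int Sa)
      - A * B * (12 * (A * of_int F + B * of_int G)) - 3 * A\<^sup>2 * B\<^sup>2 * (A + B - 2)"
    unfolding s[folded A_def B_def, symmetric] t[folded A_def B_def, symmetric]
    by (simp add: algebra_simps power2_eq_square power3_eq_cube)
  also have "\<dots> = (A * B) * (A\<^sup>2 + B\<^sup>2 + 1 - 3 * A * B)"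
    unfolding S[folded A_def B_def] FG[folded A_def B_def]
    by (simp add: algebra_simps power2_eq_square power3_eq_cube)
  finally have "(A * B) * (12 * A * B * (s + t)) = (A * B) * (A\<^sup>2 + B\<^sup>2 + 1 - 3 * A * B)" .
  moreover have "A > 0" "B > 0" using assms(1,2) by (simp_all add: A_def B_def)
  ultimately have "12 * A * B * (s + t) = A\<^sup>2 + B\<^sup>2 + 1 - 3 * A * B"
    by (simp only: mult_cancel_left) simp
  then have "12 * (s + t) = A / B + B / A + 1 / (A * B) - 3"
    using \<open>A > 0\<close> \<open>B > 0\<close> by (simp add: field_simps power2_eq_square)
  then show ?thesis by (simp add: A_def B_def s_def t_def)
qed

section \<open>The extremal multipliers\<close>

text \<open>
  After reciprocity and the trivial bound on \<open>s(b, a)\<close>, the gaps between the estimates and the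
  required bounds factor into terms that are visibly nonnegative in this range of \<open>a\<close>.
\<close>

lemma abs_dedekind_sum_le_half:
  fixes a b :: int
  assumes "coprime a b" "2 \<le> a" "2 * a \<le> b - 1"
  shows "\<bar>dedekind_sum a b\<bar> \<le> (of_int b - 1) * (of_int b - 5) / (24 * of_int b)"
proof -
  define A B where "A = real_of_int a" and "B = real_of_int b"
  define s where "s = dedekind_sum a b"
  define t where "t = dedekind_sum b a"
  have AB: "2 \<le> A" "2 * A \<le> B - 1"
    using assms(2,3) by (simp_all add: A_def B_def)
  have "12 * (s + t) = A / B + B / A + 1 / (A * B) - 3"
    using dedekind_sum_reciprocity[of a b] assms by (simp add: A_def B_def s_def t_def)
  then have s: "12 * A * B * s = A\<^sup>2 + B\<^sup>2 + 1 - 3 * A * B - B * (12 * A * t)"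
    using AB by (simp add: field_simps power2_eq_square)
  have "\<bar>t\<bar> \<le> (A - 1) * (A - 2) / (12 * A)"
    using abs_dedekind_sum_le[of a b] assms
    by (simp add: A_def t_def coprime_commute)
  then have "\<bar>12 * A * t\<bar> \<le> (A - 1) * (A - 2)"
    using AB by (simp add: abs_mult field_simps)
  then have t: "B * (12 * A * t) \<le> B * ((A - 1) * (A - 2))" "B * (- (12 * A * t)) \<le> B * ((A - 1) * (A - 2))"
    using AB by (intro mult_left_mono; linarith)+
  \<comment> \<open>These are the two gaps, upper and lower, multiplied by \<open>24 A B\<close>.\<close>
  have "0 \<le> (B + 1) * (A - 2) * (B + 1 - 2 * A)" "0 \<le> (B - 1) * (A + 2) * (B - 1 - 2 * A)"
    using AB by simp_all
  with s t have "A * (24 * B * s) \<le> A * ((B - 1) * (B - 5))"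
    "A * (- (24 * B * s)) \<le> A * ((B - 1) * (B - 5))"
    by (simp_all add: algebra_simps power2_eq_square)
  then have "\<bar>24 * B * s\<bar> \<le> (B - 1) * (B - 5)"
    using AB by (simp only: mult_le_cancel_left_pos abs_le_iff)
  then show ?thesis
    using AB by (simp add: abs_mult field_simps flip: A_def B_def s_def)
qed

lemma dedekind_sum_2:
  fixes b :: int
  assumes "b > 0" "odd b"
  shows "dedekind_sum 2 b = (of_int b - 1) * (of_int b - 5) / (24 * of_int b)"
proof -
  \<comment> \<open>The trivial bound is zero for modulus \<open>2\<close>.\<close>
  have "dedekind_sum b 2 = 0"
    using abs_dedekind_sum_le[of 2 b] assms(2) by (simp add: coprime_commute)
  then show ?thesis
    using dedekind_sum_reciprocity[of 2 b] assms by (simp add: field_simps)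
qed

lemma abs_dedekind_sum_le_nontrivial:
  fixes a b :: int
  assumes "coprime a b" "2 \<le> a" "a \<le> b - 2"
  shows "\<bar>dedekind_sum a b\<bar> \<le> (of_int b - 1) * (of_int b - 5) / (24 * of_int b)"
proof (cases "2 * a \<le> b - 1")
  case False
  have "2 * a \<noteq> b"
  proof
    assume "2 * a = b"
    then have "a dvd b" by auto
    then have "is_unit a" by (rule coprime_common_divisor[OF assms(1) dvd_refl])
    then show False using assms(2) by auto
  qed
  with False have half: "2 * (b - a) \<le> b - 1" by presburger
  have cong: "[- a = b - a] (mod b)" by (simp add: cong_def mod_simps)
  have "coprime (b - a) b"
    using assms(1) by (intro cong_imp_coprime[OF cong]) simp
  with half have "\<bar>dedekind_sum (b - a) b\<bar> \<le> (of_int b - 1) * (of_int b - 5) / (24 * of_int b)"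
    using abs_dedekind_sum_le_half[of "b - a" b] assms(3) by simp
  moreover have "dedekind_sum (b - a) b = dedekind_sum (- a) b"
    using assms by (intro dedekind_sum_cong[symmetric] cong) auto
  ultimately show ?thesis by (simp add: dedekind_sum_uminus)
qed (use assms abs_dedekind_sum_le_half in blast)

theorem proposition2p6:
  fixes a b :: int
  assumes "b > 0"
  shows
    "(coprime a b \<and> 2 \<le> a \<and> a \<le> b - 2 \<longrightarrow>
        ((real_of_int b ^ 2 - 1) / 8 \<le> real (inv_mult a b) \<and>
         real (inv_mult a b) \<le> (3 * real_of_int b ^ 2 - 12 * real_of_int b + 9) / 8) \<and>
        (- ((real_of_int b - 1) * (real_of_int b - 5) / (24 * real_of_int b)) \<le> dedekind_sum a b \<and>
         dedekind_sum a b \<le> (real_of_int b - 1) * (real_of_int b - 5) / (24 * real_of_int b))) \<and>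
     (odd b \<longrightarrow>
        real (inv_mult 2 b) = (real_of_int b ^ 2 - 1) / 8 \<and>
        real (inv_mult (- 2) b) = (3 * real_of_int b ^ 2 - 12 * real_of_int b + 9) / 8 \<and>
        dedekind_sum 2 b = (real_of_int b - 1) * (real_of_int b - 5) / (24 * real_of_int b) \<and>
        dedekind_sum (- 2) b = - ((real_of_int b - 1) * (real_of_int b - 5) / (24 * real_of_int b)))"
proof -
  define M where "M = (real_of_int b - 1) * (real_of_int b - 5) / (24 * real_of_int b)"
  have M: "24 * of_int b * M = (of_int b - 1) * (of_int b - 5)"
    using assms by (simp add: M_def)
  \<comment> \<open>The gaps to the two bounds on inversions are the gaps for \<open>dedekind_sum\<close> times \<open>3 * b\<close>.\<close>
  have inv_eq: "real (inv_mult c b) = (of_int b ^ 2 - 1) / 8 + 3 * of_int b * (M - dedekind_sum c b)"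
    "real (inv_mult c b) = (3 * of_int b ^ 2 - 12 * of_int b + 9) / 8 - 3 * of_int b * (M + dedekind_sum c b)"
    if "coprime c b" for c
    using inv_mult_eq_dedekind_sum[OF assms that] M
    by (simp_all add: algebra_simps power2_eq_square add_divide_distrib diff_divide_distrib)
  have bounds: "- M \<le> dedekind_sum a b" "dedekind_sum a b \<le> M"
      "0 \<le> 3 * of_int b * (M - dedekind_sum a b)" "0 \<le> 3 * of_int b * (M + dedekind_sum a b)"
    if "coprime a b" "2 \<le> a" "a \<le> b - 2"
    using abs_dedekind_sum_le_nontrivial[OF that] assms by (simp_all add: M_def[symmetric] abs_le_iff)
  have s2: "dedekind_sum 2 b = M" "dedekind_sum (- 2) b = - M" if "odd b"
    using dedekind_sum_2[OF assms that] by (simp_all add: M_def dedekind_sum_uminus)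
  have cop: "coprime 2 b" "coprime (- 2) b" if "odd b"
    using that by auto
  have "(of_int b ^ 2 - 1) / 8 \<le> real (inv_mult a b)"
    "real (inv_mult a b) \<le> (3 * of_int b ^ 2 - 12 * of_int b + 9) / 8"
    if "coprime a b" "2 \<le> a" "a \<le> b - 2"
    using bounds(3,4)[OF that] inv_eq[OF that(1)] by linarith+
  moreover have "real (inv_mult 2 b) = (of_int b ^ 2 - 1) / 8"
    "real (inv_mult (- 2) b) = (3 * of_int b ^ 2 - 12 * of_int b + 9) / 8" if "odd b"
    using inv_eq(1)[OF cop(1)[OF that]] inv_eq(2)[OF cop(2)[OF that]] s2[OF that] by simp_all
  ultimately show ?thesis unfolding M_def[symmetric] using bounds(1,2) s2 by blast
qed

end
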